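(* Let $m\in\mathbb{Z}_{>0}$, $\varphi\in L^1_m(\mathbb{R}^n)$, and $\alpha\in\mathbb{Z}_{\ge0}^n$ with $|\alpha|=m$. Then $x^\alpha e^{t\nu\Delta}\varphi\in L^1(\mathbb{R}^n)$ and the identity $$[x^\alpha,e^{t\nu\Delta}]\varphi=R_\alpha(t)\varphi$$ holds in $L^1(\mathbb{R}^n)$ for any $t>0$, where $[x^\alpha,e^{t\nu\Delta}]\varphi:=x^\alpha e^{t\nu\Delta}\varphi-e^{t\nu\Delta}x^\alpha\varphi$ and $$R_\alpha(t)\varphi:=\sum_{\substack{\beta+\gamma=\alpha\\\beta\ne0}}\frac{\alpha!}{\beta!\gamma!}(-2t\nu\partial)^\beta e^{t\nu\Delta}x^\gamma\varphi+\sum_{\substack{\beta+\gamma\le\alpha,\ |\beta+\gamma|\le|\alpha|-2\\|\beta|+1\le\ell\le\frac{|\alpha|+|\beta|-|\gamma|}2}}C^\alpha_{\ell\beta\gamma}(t\nu)^\ell\partial^\beta e^{t\nu\Delta}x^\gamma\varphi$$ for some $C^\alpha_{\ell\beta\gamma}\in\mathbb{R}$ independent of $\nu$, $t$, $x$, and $\varphi$.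
   Context: Let $n\in\mathbb{Z}_{>0}$ and $\nu\in\mathbb{C}$ with $\operatorname{Re}\nu>0$. $G_{t\nu}(x)=(4\pi t\nu)^{-n/2}\exp\left(-\frac{|x|^2}{4t\nu}\right)$ (principal branch of the power), and $e^{t\nu\Delta}\varphi=G_{t\nu}*\varphi$ for $t>0$. The sums run over $\beta,\gamma\in\mathbb{Z}_{\ge0}^n$ and integers $\ell\ge0$ subject to the displayed conditions (empty sums are $0$). For multi-indices, $|\alpha|=\sum_j\alpha_j$, $\alpha!=\prod_j\alpha_j!$, $x^\alpha=\prod_jx_j^{\alpha_j}$, $\partial^\alpha=\prod_j\partial_j^{\alpha_j}$, $\alpha\le\beta$ means $\alpha_j\le\beta_j$ for all $j$, and $(-2t\nu\partial)^\beta=(-2t\nu)^{|\beta|}\partial^\beta$. Expressions such as $e^{t\nu\Delta}x^\gamma\varphi$ mean $e^{t\nu\Delta}$ applied to the function $x\mapsto x^\gamma\varphi(x)$. For $m\in\mathbb{Z}_{>0}$, $L^1_m(\mathbb{R}^n)$ is the set of complex-valued $\varphi\in L^1(\mathbb{R}^n)$ with $x^\alpha\varphi\in L^1(\mathbb{R}^n)$ for all $|\alpha|\le m$. *)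

theory Defs
  imports "HOL-Analysis.Analysis"
begin

text \<open>
  Multi-indices are elements of \<open>nat^'n\<close>, for which the library order \<open>\<le>\<close> is componentwise.
\<close>

definition mi_abs :: "nat^'n \<Rightarrow> nat" where
  "mi_abs \<alpha> = (\<Sum>j\<in>UNIV. \<alpha> $ j)"

definition mi_fact :: "nat^'n \<Rightarrow> nat" where
  "mi_fact \<alpha> = (\<Prod>j\<in>UNIV. fact (\<alpha> $ j))"

definition monomial :: "nat^'n \<Rightarrow> real^'n \<Rightarrow> real" where
  "monomial \<alpha> x = (\<Prod>j\<in>UNIV. (x $ j) ^ (\<alpha> $ j))"

definition mult_monomial :: "nat^'n \<Rightarrow> (real^'n \<Rightarrow> complex) \<Rightarrow> (real^'n \<Rightarrow> complex)" where
  "mult_monomial \<alpha> \<phi> = (\<lambda>x. of_real (monomial \<alpha> x) * \<phi> x)"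

definition partial_deriv :: "'n \<Rightarrow> (real^'n \<Rightarrow> complex) \<Rightarrow> (real^'n \<Rightarrow> complex)" where
  "partial_deriv j f = (\<lambda>x. vector_derivative (\<lambda>s. f (x + s *\<^sub>R axis j 1)) (at 0))"

text \<open>
  The product of the \<open>\<partial>\<^sub>j\<close> to the powers \<open>\<beta>\<^sub>j\<close>, composed in the order given by some fixed
  enumeration of the coordinates. The enumeration is irrelevant for smooth functions, and
  the operator is only applied to functions \<open>heat z \<psi>\<close> with \<open>Re z > 0\<close> and \<open>\<psi>\<close> integrable,
  which are smooth.
\<close>

definition coords :: "'n::finite list" where
  "coords = (SOME js. set js = UNIV \<and> distinct js)"

definition multi_deriv :: "nat^'n \<Rightarrow> (real^'n \<Rightarrow> complex) \<Rightarrow> (real^'n \<Rightarrow> complex)" where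
  "multi_deriv \<beta> = foldr (\<lambda>j. partial_deriv j ^^ (\<beta> $ j)) coords"

text \<open>\<open>L\<^sup>1\<close> consists of Lebesgue (not just Borel) integrable functions; its elements are
  identified up to equality almost everywhere.\<close>

definition L1 :: "(real^'n \<Rightarrow> complex) set" where
  "L1 = {\<phi>. integrable lebesgue \<phi>}"

definition eq_in_L1 :: "(real^'n \<Rightarrow> complex) \<Rightarrow> (real^'n \<Rightarrow> complex) \<Rightarrow> bool" where
  "eq_in_L1 f g \<longleftrightarrow> f \<in> L1 \<and> g \<in> L1 \<and> (AE x in lebesgue. f x = g x)"

definition L1_weighted :: "nat \<Rightarrow> (real^'n \<Rightarrow> complex) set" where
  "L1_weighted m = {\<phi> \<in> L1. \<forall>\<alpha>. mi_abs \<alpha> \<le> m \<longrightarrow> mult_monomial \<alpha> \<phi> \<in> L1}"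

definition convolution ::
  "(real^'n \<Rightarrow> complex) \<Rightarrow> (real^'n \<Rightarrow> complex) \<Rightarrow> (real^'n \<Rightarrow> complex)" where
  "convolution f g = (\<lambda>x. \<integral>y. f (x - y) * g y \<partial>lebesgue)"

text \<open>\<open>gauss z\<close> is \<open>G\<^sub>z\<close> and \<open>heat z\<close> is \<open>e\<^bsup>z\<Delta>\<^esup>\<close>, where \<open>z = t\<nu>\<close>. The complex \<open>powr\<close> is the
  principal branch.\<close>

definition gauss :: "complex \<Rightarrow> real^'n \<Rightarrow> complex" where
  "gauss z x = (4 * of_real pi * z) powr (- (of_nat CARD('n) / 2))
     * exp (- (of_real ((norm x)\<^sup>2) / (4 * z)))"

definition heat :: "complex \<Rightarrow> (real^'n \<Rightarrow> complex) \<Rightarrow> (real^'n \<Rightarrow> complex)" where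
  "heat z \<phi> = convolution (gauss z) \<phi>"

definition commutator ::
  "(('a \<Rightarrow> complex) \<Rightarrow> ('a \<Rightarrow> complex)) \<Rightarrow> (('a \<Rightarrow> complex) \<Rightarrow> ('a \<Rightarrow> complex))
     \<Rightarrow> ('a \<Rightarrow> complex) \<Rightarrow> ('a \<Rightarrow> complex)" where
  "commutator A B \<phi> = (\<lambda>x. A (B \<phi>) x - B (A \<phi>) x)"

text \<open>
  The index set of the second sum. On \<open>nat\<close>, \<open>|\<beta>+\<gamma>| \<le> |\<alpha>| - 2\<close> and
  \<open>\<ell> \<le> (|\<alpha>| + |\<beta>| - |\<gamma>|) / 2\<close> are written without subtraction and division.
\<close>

definition remainder_indices :: "nat^'n \<Rightarrow> (nat \<times> (nat^'n) \<times> (nat^'n)) set" where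
  "remainder_indices \<alpha> = {(l, \<beta>, \<gamma>).
     \<beta> + \<gamma> \<le> \<alpha> \<and> mi_abs (\<beta> + \<gamma>) + 2 \<le> mi_abs \<alpha> \<and>
     mi_abs \<beta> + 1 \<le> l \<and> 2 * l + mi_abs \<gamma> \<le> mi_abs \<alpha> + mi_abs \<beta>}"

definition remainder ::
  "(nat \<Rightarrow> nat^'n \<Rightarrow> nat^'n \<Rightarrow> real) \<Rightarrow> nat^'n \<Rightarrow> complex \<Rightarrow> real
     \<Rightarrow> (real^'n \<Rightarrow> complex) \<Rightarrow> (real^'n \<Rightarrow> complex)" where
  "remainder C \<alpha> \<nu> t \<phi> = (\<lambda>x.
     (\<Sum>(\<beta>, \<gamma>)\<in>{(\<beta>, \<gamma>). \<beta> + \<gamma> = \<alpha> \<and> \<beta> \<noteq> 0}.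
        of_nat (mi_fact \<alpha>) / of_nat (mi_fact \<beta> * mi_fact \<gamma>)
        * ((- 2 * of_real t * \<nu>) ^ mi_abs \<beta>
           * multi_deriv \<beta> (heat (of_real t * \<nu>) (mult_monomial \<gamma> \<phi>)) x)) +
     (\<Sum>(l, \<beta>, \<gamma>)\<in>remainder_indices \<alpha>.
        of_real (C l \<beta> \<gamma>) * (of_real t * \<nu>) ^ l
        * multi_deriv \<beta> (heat (of_real t * \<nu>) (mult_monomial \<gamma> \<phi>)) x))"

text \<open>Both index sets are finite, so neither sum is zero by convention.\<close>

lemma finite_mi_atMost: "finite {\<beta> :: nat^'n. \<beta> \<le> \<alpha>}"
proof -
  have "finite {f. \<forall>i. f i \<in> {..\<alpha> $ i}}"
    using finite_PiE[of UNIV "\<lambda>i. {..\<alpha> $ i}"]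
    by (simp only: PiE_UNIV_domain Pi_def finite finite_atMost simp_thms UNIV_I)
  then have "finite (vec_lambda ` {f. \<forall>i. f i \<in> {..\<alpha> $ i}})"
    by blast
  moreover have "{\<beta>. \<beta> \<le> \<alpha>} \<subseteq> vec_lambda ` {f. \<forall>i. f i \<in> {..\<alpha> $ i}}"
  proof
    fix \<beta> :: "nat^'n" assume "\<beta> \<in> {\<beta>. \<beta> \<le> \<alpha>}"
    then have "vec_nth \<beta> \<in> {f. \<forall>i. f i \<in> {..\<alpha> $ i}}"
      by (simp add: less_eq_vec_def)
    then show "\<beta> \<in> vec_lambda ` {f. \<forall>i. f i \<in> {..\<alpha> $ i}}"
      by (intro image_eqI[of _ _ "vec_nth \<beta>"]) (simp_all add: vec_nth_inverse)
  qed
  ultimately show ?thesis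
    by (rule rev_finite_subset)
qed

lemma finite_binomial_indices: "finite {(\<beta> :: nat^'n, \<gamma>). \<beta> + \<gamma> = \<alpha> \<and> \<beta> \<noteq> 0}"
proof (rule finite_subset)
  show "{(\<beta>, \<gamma>). \<beta> + \<gamma> = \<alpha> \<and> \<beta> \<noteq> 0} \<subseteq> {\<beta>. \<beta> \<le> \<alpha>} \<times> {\<gamma>. \<gamma> \<le> \<alpha>}"
    by (auto simp: less_eq_vec_def)
qed (intro finite_SigmaI finite_mi_atMost)

lemma finite_remainder_indices: "finite (remainder_indices (\<alpha> :: nat^'n))"
proof (rule finite_subset)
  show "remainder_indices \<alpha> \<subseteq> {..2 * mi_abs \<alpha>} \<times> {\<beta>. \<beta> \<le> \<alpha>} \<times> {\<gamma>. \<gamma> \<le> \<alpha>}"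
  proof
    fix p assume "p \<in> remainder_indices \<alpha>"
    then obtain l \<beta> \<gamma> where p: "p = (l, \<beta>, \<gamma>)" and le: "\<beta> + \<gamma> \<le> \<alpha>"
      and l: "2 * l + mi_abs \<gamma> \<le> mi_abs \<alpha> + mi_abs \<beta>"
      by (auto simp: remainder_indices_def)
    have "\<beta> $ i + \<gamma> $ i \<le> \<alpha> $ i" for i
      using le by (auto simp: less_eq_vec_def)
    then have "\<beta> $ i \<le> \<alpha> $ i \<and> \<gamma> $ i \<le> \<alpha> $ i" for i
      by (metis add_leD1 add_leD2)
    then have \<beta>\<gamma>: "\<beta> \<le> \<alpha>" "\<gamma> \<le> \<alpha>"
      by (auto simp: less_eq_vec_def)
    then have "mi_abs \<beta> \<le> mi_abs \<alpha>"
      by (auto simp: mi_abs_def less_eq_vec_def intro: sum_mono)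
    with p l \<beta>\<gamma> show "p \<in> {..2 * mi_abs \<alpha>} \<times> {\<beta>. \<beta> \<le> \<alpha>} \<times> {\<gamma>. \<gamma> \<le> \<alpha>}"
      by auto
  qed
qed (intro finite_SigmaI finite_mi_atMost finite_atMost)

end

theory Submission
  imports Defs
begin

text \<open>
  Put \<open>z = t\<nu>\<close>, let \<open>g(s) = exp (-s\<^sup>2/(4z))\<close> be the one-dimensional Gaussian and
  \<open>H\<^sub>i = (-2z d/ds)\<^sup>i g\<close>. Then \<open>s H\<^sub>i = H\<^bsub>i+1\<^esub> + 2zi H\<^bsub>i-1\<^esub>\<close>, and with \<open>x = u + y\<close> induction on \<open>k\<close> gives
  \<open>x\<^sup>k g(u) = \<Sum>\<^bsub>i+2d+c=k\<^esub> k!/(i! d! c!) z\<^sup>d H\<^sub>i(u) y\<^sup>c\<close>.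
  Taking the product over the coordinates with \<open>u = x - y\<close>, multiplying by \<open>\<phi>(y)\<close>, integrating in \<open>y\<close> and
  moving the derivatives out of the convolution, one obtains pointwise
  \<open>x\<^sup>\<alpha> e\<^bsup>z\<Delta>\<^esup>\<phi> = \<Sum>\<^bsub>\<beta>+2\<delta>+\<gamma>=\<alpha>\<^esub> \<alpha>!/(\<beta>! \<delta>! \<gamma>!) (-2)\<^bsup>|\<beta>|\<^esup> z\<^bsup>|\<beta>|+|\<delta>|\<^esup> \<partial>\<^sup>\<beta> e\<^bsup>z\<Delta>\<^esup> x\<^sup>\<gamma> \<phi>\<close>.
  The term \<open>\<beta> = \<delta> = 0\<close> is \<open>e\<^bsup>z\<Delta>\<^esup> x\<^sup>\<alpha> \<phi>\<close>, the other terms with \<open>\<delta> = 0\<close> form the first sum of \<open>R\<^sub>\<alpha>(t)\<phi>\<close>,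
  and those with \<open>\<delta> \<noteq> 0\<close> form the second one with \<open>\<ell> = |\<beta>| + |\<delta>|\<close>.
\<close>

section \<open>Integrals and convolutions\<close>

text \<open>The difference-quotient form suits limits along sequences under an integral, and moving
  the base point becomes plain algebra in it.\<close>

lemma has_vector_derivative_iff_tendsto:
  fixes f :: "real \<Rightarrow> 'b::real_normed_vector"
  shows "(f has_vector_derivative D) (at x) \<longleftrightarrow> ((\<lambda>h. (f (x + h) - f x) /\<^sub>R h) \<longlongrightarrow> D) (at 0)"
proof -
  have *: "norm ((f (x + h) - f x) /\<^sub>R h - D) = norm (f (x + h) - f x - h *\<^sub>R D) / norm h" if "h \<noteq> 0" for h
  proof -
    have "(f (x + h) - f x) /\<^sub>R h - D = (f (x + h) - f x - h *\<^sub>R D) /\<^sub>R h"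
      using that by (simp add: scaleR_diff_right)
    then show ?thesis by (simp add: divide_inverse mult.commute)
  qed
  show ?thesis
    unfolding has_vector_derivative_def has_derivative_at
    apply (subst LIM_zero_iff[symmetric, of _ D])
    apply (subst tendsto_norm_zero_iff[symmetric, of "\<lambda>h. _ h - D"])
    apply (simp add: bounded_linear_scaleR_left)
    by (rule filterlim_cong) (auto simp: * eventually_at_filter)
qed

section \<open>Integrability of Gaussians\<close>

text \<open>The antiderivative is \<open>arctan\<close>, so each half-line contributes
  \<open>pi / 2\<close>; reflection reduces the negative half-line to the positive one. This
  function serves as majorant of the Gaussian.\<close>

lemma integrable_inverse_one_plus_square: "integrable lborel (\<lambda>s::real. inverse (1 + s\<^sup>2))"
proof (rule integrableI_bounded)
  have half: "(\<integral>\<^sup>+ s. ennreal (inverse (1 + s\<^sup>2)) * indicator {0..} s \<partial>lborel) = ennreal (pi / 2 - arctan 0)"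
    by (rule nn_integral_FTC_atLeast)
      (auto simp: DERIV_arctan tendsto_arctan_at_top add_nonneg_nonneg)
  have half': "(\<integral>\<^sup>+ s. ennreal (inverse (1 + s\<^sup>2)) * indicator {0..} (- s) \<partial>lborel) = ennreal (pi / 2 - arctan 0)"
    using half nn_integral_real_affine[of "\<lambda>s. ennreal (inverse (1 + s\<^sup>2)) * indicator {0..} (- s)" "-1" 0]
    by simp
  have "(\<integral>\<^sup>+ s. ennreal (norm (inverse (1 + s\<^sup>2 :: real))) \<partial>lborel)
    \<le> (\<integral>\<^sup>+ s. ennreal (inverse (1 + s\<^sup>2)) * indicator {0..} s
        + ennreal (inverse (1 + s\<^sup>2)) * indicator {0..} (- s) \<partial>lborel)"
    by (rule nn_integral_mono) (auto simp: indicator_def simp flip: ennreal_plus)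
  also have "\<dots> = ennreal (pi / 2 - arctan 0) + ennreal (pi / 2 - arctan 0)"
    by (subst nn_integral_add) (auto simp only: half half', measurable)
  also have "\<dots> < \<infinity>" by simp
  finally show "(\<integral>\<^sup>+ s. ennreal (norm (inverse (1 + s\<^sup>2 :: real))) \<partial>lborel) < \<infinity>" .
qed simp

text \<open>By \<open>exp u >= 1 + u\<close>, since \<open>(1 + 1 / r) * (1 + r * s^2)\<close>
  exceeds \<open>1 + s^2\<close> by \<open>1 / r + r * s^2\<close>.\<close>

lemma one_plus_square_le_exp:
  assumes "r > (0::real)"
  shows "1 + s\<^sup>2 \<le> (1 + 1 / r) * exp (r * s\<^sup>2)"
proof -
  have "1 + s\<^sup>2 \<le> (1 + 1 / r) * (1 + r * s\<^sup>2)"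
    using assms by (simp add: field_simps)
  also have "\<dots> \<le> (1 + 1 / r) * exp (r * s\<^sup>2)"
    using assms by (intro mult_left_mono exp_ge_add_one_self) auto
  finally show ?thesis .
qed

lemma integrable_exp_neg_square:
  assumes "r > (0::real)"
  shows "integrable lborel (\<lambda>s. exp (- (r * s\<^sup>2)))"
proof (rule Bochner_Integration.integrable_bound)
  show "integrable lborel (\<lambda>s::real. (1 + 1 / r) * inverse (1 + s\<^sup>2))"
    by (intro integrable_mult_right integrable_inverse_one_plus_square)
  have "exp (- (r * s\<^sup>2)) \<le> (1 + 1 / r) * inverse (1 + s\<^sup>2)" for s
    using one_plus_square_le_exp[OF assms, of s]
    by (simp add: exp_minus divide_simps add_pos_nonneg)
  then show "AE s in lborel. norm (exp (- (r * s\<^sup>2))) \<le> norm ((1 + 1 / r) * inverse (1 + s\<^sup>2))"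
    using assms by (intro AE_I2) (simp add: abs_mult)
qed simp

lemma norm_vec_power2: "(norm (x :: real^'n))\<^sup>2 = (\<Sum>j\<in>UNIV. (x $ j)\<^sup>2)"
  by (simp add: norm_vec_def L2_set_def sum_nonneg)

text \<open>The exponential factorises over the coordinates, so Tonelli yields a finite product of
  one-dimensional integrals.\<close>

lemma integrable_exp_neg_norm_square:
  assumes "r > (0::real)"
  shows "integrable lborel (\<lambda>x :: 'a::euclidean_space. exp (- (r * (norm x)\<^sup>2)))"
proof (rule integrableI_bounded)
  have "exp (- (r * (norm x)\<^sup>2)) = (\<Prod>b\<in>Basis. exp (- (r * (x \<bullet> b)\<^sup>2)))" for x :: 'a
    by (simp add: norm_eq_sqrt_inner euclidean_inner[of x x] sum_nonneg power2_eq_square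
        sum_distrib_left flip: exp_sum sum_negf)
  then have "(\<integral>\<^sup>+ x. ennreal (norm (exp (- (r * (norm (x::'a))\<^sup>2)))) \<partial>lborel)
      = (\<integral>\<^sup>+ x. (\<Prod>b\<in>Basis. ennreal (exp (- (r * (x \<bullet> b)\<^sup>2)))) \<partial>(lborel :: 'a measure))"
    by (simp add: prod_ennreal abs_of_nonneg prod_nonneg)
  also have "\<dots> = (\<Prod>b\<in>(Basis::'a set). (\<integral>\<^sup>+ s. ennreal (exp (- (r * s\<^sup>2))) \<partial>lborel))"
    by (rule nn_integral_lborel_prod) auto
  also have "\<dots> < \<infinity>"
    using integrable_exp_neg_square[OF assms]
    by (auto simp: integrable_iff_bounded less_top ennreal_prod_eq_top power_less_top_ennreal)
  finally show "(\<integral>\<^sup>+ x. ennreal (norm (exp (- (r * (norm (x::'a))\<^sup>2)))) \<partial>lborel) < \<infinity>" .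
qed simp

section \<open>Convolution with an integrable function\<close>

text \<open>Tonelli and Fubini for the product of two copies of \<open>lborel\<close> need Borel
  measurability, so a Lebesgue integrable function is first replaced by a Borel representative,
  built from its real and imaginary parts.\<close>

lemma lebesgue_integrable_ex_borel:
  fixes \<psi> :: "'a::euclidean_space \<Rightarrow> complex"
  assumes "integrable lebesgue \<psi>"
  obtains g where "g \<in> borel_measurable borel" "AE x in lebesgue. \<psi> x = g x" "integrable lborel g"
proof -
  have "\<psi> \<in> borel_measurable lebesgue" using assms by auto
  then have "(\<lambda>x. Re (\<psi> x)) \<in> borel_measurable lebesgue" "(\<lambda>x. Im (\<psi> x)) \<in> borel_measurable lebesgue"
    by measurable
  then obtain u v where [measurable]: "u \<in> borel_measurable lborel" "v \<in> borel_measurable lborel"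
    and uv: "AE x in lborel. Re (\<psi> x) = u x" "AE x in lborel. Im (\<psi> x) = v x"
    by (metis completion_ex_borel_measurable_real)
  define g where "g = (\<lambda>x. Complex (u x) (v x))"
  have [measurable]: "g \<in> borel_measurable borel"
    unfolding g_def Complex_eq by measurable
  have ae: "AE x in lebesgue. \<psi> x = g x"
    by (rule AE_completion) (use uv in eventually_elim, simp add: g_def complex_eq_iff)
  have "integrable lebesgue g"
    using assms by (rule integrable_cong_AE_imp) (use ae in \<open>auto intro!: measurable_completion\<close>)
  then have "integrable lborel g"
    by (simp add: integrable_completion)
  then show ?thesis
    using that ae by simp
qed

text \<open>Young's inequality for two integrable functions, by Tonelli and translation invariance.
  For fixed \<open>x\<close>, passing to a Borel representative of \<open>\<psi>\<close> changes the
  integrand only on a null set, so the convolution is unchanged at every \<open>x\<close>.\<close>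

lemma convolution_in_L1:
  fixes k \<psi> :: "real^'n \<Rightarrow> complex"
  assumes [measurable]: "k \<in> borel_measurable borel" and k: "integrable lborel k" and \<psi>: "\<psi> \<in> L1"
  shows "convolution k \<psi> \<in> L1"
proof -
  obtain g where g[measurable]: "g \<in> borel_measurable borel" and ae: "AE x in lebesgue. \<psi> x = g x"
    and gi: "integrable lborel g"
    using \<psi> lebesgue_integrable_ex_borel by (auto simp: L1_def)
  have [measurable]: "\<psi> \<in> borel_measurable lebesgue"
    using \<psi> by (auto simp: L1_def)
  have km: "(\<lambda>y. k (x - y)) \<in> borel_measurable lebesgue" for x
    by (rule measurable_completion) simp
  have gm: "g \<in> borel_measurable lebesgue"
    by (rule measurable_completion) simp
  have eq: "convolution k \<psi> x = (\<integral>y. k (x - y) * g y \<partial>lborel)" for x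
  proof -
    have "convolution k \<psi> x = (\<integral>y. k (x - y) * g y \<partial>lebesgue)"
      unfolding convolution_def using ae km gm
      by (intro integral_cong_AE borel_measurable_times) auto
    then show ?thesis
      by (simp add: integral_completion)
  qed
  have tr: "(\<integral>\<^sup>+ x. ennreal (norm (k (x - y))) \<partial>lborel) = (\<integral>\<^sup>+ x. ennreal (norm (k x)) \<partial>lborel)" for y
    by (subst lborel_distr_plus[of "-y", symmetric], subst nn_integral_distr) auto
  have "integrable (lborel \<Otimes>\<^sub>M lborel) (\<lambda>(x, y). k (x - y) * g y)"
  proof (rule integrableI_bounded)
    have "(\<integral>\<^sup>+ p. ennreal (norm (case p of (x, y) \<Rightarrow> k (x - y) * g y)) \<partial>(lborel \<Otimes>\<^sub>M lborel))
      = (\<integral>\<^sup>+ y. (\<integral>\<^sup>+ x. ennreal (norm (k (x - y))) * ennreal (norm (g y)) \<partial>lborel) \<partial>lborel)"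
      by (subst lborel_pair.nn_integral_snd[symmetric]) (auto simp: norm_mult ennreal_mult)
    also have "\<dots> = (\<integral>\<^sup>+ x. ennreal (norm (k x)) \<partial>lborel) * (\<integral>\<^sup>+ y. ennreal (norm (g y)) \<partial>lborel)"
      by (simp add: nn_integral_multc nn_integral_cmult tr)
    also have "\<dots> < \<infinity>"
      using k gi by (simp add: integrable_iff_bounded ennreal_mult_less_top)
    finally show "(\<integral>\<^sup>+ p. ennreal (norm (case p of (x, y) \<Rightarrow> k (x - y) * g y)) \<partial>(lborel \<Otimes>\<^sub>M lborel)) < \<infinity>" .
  qed simp
  then have "integrable lborel (\<lambda>x. \<integral>y. k (x - y) * g y \<partial>lborel)"
    using lborel_pair.integrable_fst'[of "\<lambda>(x, y). k (x - y) * g y"] by simp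
  then have "integrable lborel (convolution k \<psi>)"
    by (simp add: eq[abs_def])
  then show ?thesis
    by (simp add: L1_def integrable_completion)
qed

text \<open>A bounded kernel makes the convolution integral converge at every \<open>x\<close>, not
  just almost everywhere; this is what permits pointwise identities later.\<close>

lemma integrable_convolution_integrand:
  fixes k \<psi> :: "real^'n \<Rightarrow> complex"
  assumes [measurable]: "k \<in> borel_measurable borel" and k: "\<And>x. norm (k x) \<le> B" and \<psi>: "\<psi> \<in> L1"
  shows "integrable lebesgue (\<lambda>y. k (x - y) * \<psi> y)"
proof (rule Bochner_Integration.integrable_bound)
  have "integrable lebesgue \<psi>" using \<psi> by (simp add: L1_def)
  then show "integrable lebesgue (\<lambda>y. B * norm (\<psi> y))"
    by (intro integrable_mult_right integrable_norm)
  have "(\<lambda>y. k (x - y)) \<in> borel_measurable lebesgue"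
    by (rule measurable_completion) simp
  then show "(\<lambda>y. k (x - y) * \<psi> y) \<in> borel_measurable lebesgue"
    using \<open>integrable lebesgue \<psi>\<close> by auto
  have "norm (k (x - y) * \<psi> y) \<le> norm (B * norm (\<psi> y))" for y
    using order_trans[OF k[of "x - y"] abs_ge_self] by (simp add: norm_mult abs_mult mult_right_mono)
  then show "AE y in lebesgue. norm (k (x - y) * \<psi> y) \<le> norm (B * norm (\<psi> y))"
    by simp
qed

text \<open>Differentiation under the integral by dominated convergence: the bound on
  \<open>k'\<close> makes \<open>k\<close> Lipschitz in direction \<open>j\<close>, so the
  difference quotients are dominated by \<open>B * norm (\<psi> y)\<close>.\<close>

lemma partial_deriv_convolution:
  fixes k k' \<psi> :: "real^'n \<Rightarrow> complex"
  assumes [measurable]: "k \<in> borel_measurable borel" "k' \<in> borel_measurable borel"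
    and k: "\<And>x. norm (k x) \<le> A" and k': "\<And>x. norm (k' x) \<le> B"
    and deriv: "\<And>x. ((\<lambda>s. k (x + s *\<^sub>R axis j 1)) has_vector_derivative k' x) (at 0)"
    and \<psi>: "\<psi> \<in> L1"
  shows "partial_deriv j (convolution k \<psi>) = convolution k' \<psi>"
proof
  fix x :: "real^'n"
  define e :: "real^'n" where "e = axis j 1"
  \<comment> \<open>The hypothesis gives the derivative at parameter \<open>0\<close> of each line;
    moving the base point gives it at every parameter, as the mean value inequality
    requires.\<close>
  have deriv': "((\<lambda>s. k (y + s *\<^sub>R e)) has_vector_derivative k' (y + s0 *\<^sub>R e)) (at s0)" for y s0
    using deriv[of "y + s0 *\<^sub>R e"] unfolding has_vector_derivative_iff_tendsto e_def
    by (simp add: algebra_simps)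
  have lip: "norm (k (y + s *\<^sub>R e) - k y) \<le> B * \<bar>s\<bar>" for y s
  proof -
    have "norm (k (y + s *\<^sub>R e) - k (y + 0 *\<^sub>R e)) \<le> B * norm (s - 0)"
    proof (rule differentiable_bound[of UNIV "\<lambda>s. k (y + s *\<^sub>R e)"])
      fix u :: real
      show "((\<lambda>s. k (y + s *\<^sub>R e)) has_derivative (\<lambda>h. h *\<^sub>R k' (y + u *\<^sub>R e))) (at u)"
        using deriv'[of y u] by (simp add: has_vector_derivative_def)
      show "onorm (\<lambda>h. h *\<^sub>R k' (y + u *\<^sub>R e)) \<le> B"
        using k'[of "y + u *\<^sub>R e"] order_trans[OF norm_ge_zero k'[of "y + u *\<^sub>R e"]]
        by (intro onorm_bound) (auto simp: mult.commute[of B] intro: mult_left_mono)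
    qed auto
    then show ?thesis by simp
  qed
  have int: "integrable lebesgue (\<lambda>y. k (x - y) * \<psi> y)" for x
    by (rule integrable_convolution_integrand[OF _ k \<psi>]) simp
  have int': "integrable lebesgue (\<lambda>y. k' (x - y) * \<psi> y)" for x
    by (rule integrable_convolution_integrand[OF _ k' \<psi>]) simp
  have "((\<lambda>s. (convolution k \<psi> (x + s *\<^sub>R e) - convolution k \<psi> x) /\<^sub>R s) \<longlongrightarrow> convolution k' \<psi> x) (at 0)"
    unfolding tendsto_at_iff_sequentially comp_def
  proof (intro allI impI)
    fix X :: "nat \<Rightarrow> real" assume X: "\<forall>i. X i \<in> UNIV - {0}" "X \<longlonglongrightarrow> 0"
    have eq: "(convolution k \<psi> (x + X i *\<^sub>R e) - convolution k \<psi> x) /\<^sub>R X i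
      = (\<integral>y. ((k (x - y + X i *\<^sub>R e) - k (x - y)) /\<^sub>R X i) * \<psi> y \<partial>lebesgue)" for i
    proof -
      have "(convolution k \<psi> (x + X i *\<^sub>R e) - convolution k \<psi> x) /\<^sub>R X i
        = (\<integral>y. (k (x + X i *\<^sub>R e - y) * \<psi> y - k (x - y) * \<psi> y) /\<^sub>R X i \<partial>lebesgue)"
        unfolding convolution_def using int by simp
      also have "\<dots> = (\<integral>y. ((k (x - y + X i *\<^sub>R e) - k (x - y)) /\<^sub>R X i) * \<psi> y \<partial>lebesgue)"
        by (intro Bochner_Integration.integral_cong refl) (simp add: algebra_simps)
      finally show ?thesis .
    qed
    show "(\<lambda>i. (convolution k \<psi> (x + X i *\<^sub>R e) - convolution k \<psi> x) /\<^sub>R X i) \<longlonglongrightarrow> convolution k' \<psi> x"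
      unfolding eq unfolding convolution_def
    proof (rule integral_dominated_convergence[where w = "\<lambda>y. B * norm (\<psi> y)"])
      show "(\<lambda>y. k' (x - y) * \<psi> y) \<in> borel_measurable lebesgue"
        using int'[of x] by (rule borel_measurable_integrable)
      have "(\<lambda>y. (k (x - y + X i *\<^sub>R e) - k (x - y)) /\<^sub>R X i) \<in> borel_measurable lebesgue" for i
        by (rule measurable_completion) simp
      then show "(\<lambda>y. ((k (x - y + X i *\<^sub>R e) - k (x - y)) /\<^sub>R X i) * \<psi> y) \<in> borel_measurable lebesgue" for i
        using \<psi> by (intro borel_measurable_times) (auto simp: L1_def)
      show "integrable lebesgue (\<lambda>y. B * norm (\<psi> y))"
        using \<psi> by (auto simp: L1_def)
      have "(\<lambda>i. (k (x - y + X i *\<^sub>R e) - k (x - y)) /\<^sub>R X i) \<longlonglongrightarrow> k' (x - y)" for y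
        using deriv[of "x - y"] X
        by (simp add: has_vector_derivative_iff_tendsto tendsto_at_iff_sequentially comp_def e_def)
      then show "AE y in lebesgue. (\<lambda>i. ((k (x - y + X i *\<^sub>R e) - k (x - y)) /\<^sub>R X i) * \<psi> y)
          \<longlonglongrightarrow> k' (x - y) * \<psi> y"
        by (intro AE_I2 tendsto_mult tendsto_const)
      have "norm ((k (x - y + X i *\<^sub>R e) - k (x - y)) /\<^sub>R X i) \<le> B" for i y
        using lip[of "x - y" "X i"] X(1) by (simp add: inverse_eq_divide pos_divide_le_eq)
      then show "AE y in lebesgue. norm (((k (x - y + X i *\<^sub>R e) - k (x - y)) /\<^sub>R X i) * \<psi> y)
          \<le> B * norm (\<psi> y)" for i
        unfolding norm_mult by (intro AE_I2 mult_right_mono) auto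
    qed
  qed
  then show "partial_deriv j (convolution k \<psi>) x = convolution k' \<psi> x"
    unfolding partial_deriv_def
    by (intro vector_derivative_at) (simp add: has_vector_derivative_iff_tendsto e_def)
qed

section \<open>Derivatives of the one-dimensional Gaussian\<close>

text \<open>\<open>hermite_gauss z i\<close> is \<open>(-2z d/ds)\<^sup>i\<close> applied to \<open>exp (-s\<^sup>2/(4z))\<close>; the three-term recurrence avoids
  iterated derivatives in the definition.\<close>

fun hermite_gauss :: "complex \<Rightarrow> nat \<Rightarrow> real \<Rightarrow> complex" where
  "hermite_gauss z 0 s = exp (- (of_real (s\<^sup>2) / (4 * z)))"
| "hermite_gauss z (Suc 0) s = of_real s * hermite_gauss z 0 s"
| "hermite_gauss z (Suc (Suc i)) s =
     of_real s * hermite_gauss z (Suc i) s - 2 * z * of_nat (Suc i) * hermite_gauss z i s"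

text \<open>At \<open>i = 0\<close> the truncated \<open>i - 1\<close> is harmless because its
  coefficient vanishes.\<close>

lemma hermite_gauss_recurrence:
  "of_real s * hermite_gauss z i s
    = hermite_gauss z (Suc i) s + 2 * z * of_nat i * hermite_gauss z (i - 1) s"
  by (cases i) simp_all

text \<open>This justifies reading the recurrence as iterated derivatives. In the recursive case the
  product rule yields \<open>1 + Suc i\<close> copies of \<open>hermite_gauss z (Suc i) s\<close>,
  exactly the coefficient in the next instance of the recurrence.\<close>

lemma has_vector_derivative_hermite_gauss:
  assumes "z \<noteq> 0"
  shows "(hermite_gauss z i has_vector_derivative - hermite_gauss z (Suc i) s / (2 * z)) (at s)"
  using assms
proof (induction z i s rule: hermite_gauss.induct)
  case (1 z s)
  \<comment> \<open>The derivative is computed for a complex variable and then restricted to the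
    real line.\<close>
  have "((\<lambda>w. exp (- (w\<^sup>2 / (4 * z)))) has_field_derivative
      - (of_real s * exp (- ((of_real s)\<^sup>2 / (4 * z)))) / (2 * z)) (at (of_real s))"
    using 1 by (auto intro!: derivative_eq_intros simp: field_simps)
  then show ?case
    using has_vector_derivative_real_field by fastforce
next
  case (2 z s)
  then have IH: "(hermite_gauss z 0 has_vector_derivative - hermite_gauss z (Suc 0) s / (2 * z)) (at s)"
    by blast
  have "((\<lambda>s. of_real s * hermite_gauss z 0 s) has_vector_derivative
      of_real s * (- hermite_gauss z (Suc 0) s / (2 * z)) + of_real 1 * hermite_gauss z 0 s) (at s)"
    by (intro has_vector_derivative_mult has_vector_derivative_of_real IH) auto
  moreover have "of_real s * (- hermite_gauss z (Suc 0) s / (2 * z)) + of_real 1 * hermite_gauss z 0 s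
    = - hermite_gauss z (Suc (Suc 0)) s / (2 * z)"
    using 2 by (simp add: field_simps)
  moreover have "(\<lambda>s. of_real s * hermite_gauss z 0 s) = hermite_gauss z (Suc 0)"
    by (simp add: fun_eq_iff)
  ultimately show ?case by metis
next
  case (3 z i s)
  then have IH: "(hermite_gauss z (Suc i) has_vector_derivative - hermite_gauss z (Suc (Suc i)) s / (2 * z)) (at s)"
    "(hermite_gauss z i has_vector_derivative - hermite_gauss z (Suc i) s / (2 * z)) (at s)"
    by blast+
  have "((\<lambda>s. of_real s * hermite_gauss z (Suc i) s - 2 * z * of_nat (Suc i) * hermite_gauss z i s)
      has_vector_derivative
      (of_real s * (- hermite_gauss z (Suc (Suc i)) s / (2 * z)) + of_real 1 * hermite_gauss z (Suc i) s)
      - 2 * z * of_nat (Suc i) * (- hermite_gauss z (Suc i) s / (2 * z))) (at s)"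
    by (intro has_vector_derivative_diff has_vector_derivative_mult has_vector_derivative_mult_right
        has_vector_derivative_of_real IH) auto
  moreover have "(of_real s * (- hermite_gauss z (Suc (Suc i)) s / (2 * z)) + of_real 1 * hermite_gauss z (Suc i) s)
      - 2 * z * of_nat (Suc i) * (- hermite_gauss z (Suc i) s / (2 * z))
    = - (of_real s * hermite_gauss z (Suc (Suc i)) s - 2 * z * of_nat (Suc (Suc i)) * hermite_gauss z (Suc i) s) / (2 * z)"
    using \<open>z \<noteq> 0\<close> by (simp add: divide_simps del: hermite_gauss.simps) (simp add: algebra_simps del: hermite_gauss.simps)
  moreover have "(\<lambda>s. of_real s * hermite_gauss z (Suc i) s - 2 * z * of_nat (Suc i) * hermite_gauss z i s)
    = hermite_gauss z (Suc (Suc i))"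
    by (simp add: fun_eq_iff)
  ultimately show ?case
    unfolding hermite_gauss.simps(3)[of z "Suc i" s] by metis
qed

text \<open>Allowing every rate \<open>r\<close> below \<open>Re (1/(4z))\<close> lets the induction absorb each factor \<open>s\<close> by a slight loss in the rate.\<close>

lemma norm_hermite_gauss_le:
  assumes "r < Re (1 / (4 * z))"
  shows "\<exists>M. \<forall>s. norm (hermite_gauss z i s) \<le> M * exp (- (r * s\<^sup>2))"
  using assms
proof (induction i arbitrary: r rule: less_induct)
  case (less i)
  have lin: "\<exists>M. \<forall>s. norm (of_real s * hermite_gauss z k s) \<le> M * exp (- (r * s\<^sup>2))" if k: "k < i" for k
  proof -
    \<comment> \<open>The induction hypothesis is used at an intermediate rate; the gap
      \<open>q - r\<close> pays for the factor \<open>s\<close>.\<close>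
    obtain q where q: "r < q" "q < Re (1 / (4 * z))"
      using less.prems dense by blast
    obtain M where M: "norm (hermite_gauss z k s) \<le> M * exp (- (q * s\<^sup>2))" for s
      using less.IH[OF k, of q] q(2) by blast
    have "0 \<le> M" using order_trans[OF norm_ge_zero M[of 0]] by simp
    have "norm (of_real s * hermite_gauss z k s) \<le> M * (1 + 1 / (q - r)) * exp (- (r * s\<^sup>2))" for s
    proof -
      have "0 \<le> (\<bar>s\<bar> - 1)\<^sup>2" by simp
      then have "\<bar>s\<bar> \<le> 1 + s\<^sup>2" by (simp add: power2_diff)
      also have "\<dots> \<le> (1 + 1 / (q - r)) * exp ((q - r) * s\<^sup>2)"
        using q(1) by (intro one_plus_square_le_exp) simp
      finally have "\<bar>s\<bar> * norm (hermite_gauss z k s)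
          \<le> ((1 + 1 / (q - r)) * exp ((q - r) * s\<^sup>2)) * (M * exp (- (q * s\<^sup>2)))"
        using M[of s] q(1) by (intro mult_mono) auto
      also have "\<dots> = M * (1 + 1 / (q - r)) * (exp ((q - r) * s\<^sup>2) * exp (- (q * s\<^sup>2)))"
        by simp
      also have "exp ((q - r) * s\<^sup>2) * exp (- (q * s\<^sup>2)) = exp (- (r * s\<^sup>2))"
        by (simp add: algebra_simps flip: exp_add)
      finally show ?thesis by (simp add: norm_mult)
    qed
    then show ?thesis by blast
  qed
  consider "i = 0" | "i = 1" | j where "i = Suc (Suc j)"
    by (metis One_nat_def not0_implies_Suc)
  then show ?case
  proof cases
    case 1
    have "norm (hermite_gauss z 0 s) \<le> 1 * exp (- (r * s\<^sup>2))" for s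
    proof -
      \<comment> \<open>Since \<open>norm (exp w) = exp (Re w)\<close>, the case
        \<open>i = 0\<close> only compares the two rates.\<close>
      have "r * s\<^sup>2 \<le> Re (1 / (4 * z)) * s\<^sup>2"
        using less.prems by (intro mult_right_mono) auto
      also have "\<dots> = Re (of_real (s\<^sup>2) * (1 / (4 * z)))"
        by (simp only: scaleR_conv_of_real[symmetric] scaleR_complex.sel mult.commute)
      also have "of_real (s\<^sup>2) * (1 / (4 * z)) = of_real (s\<^sup>2) / (4 * z)"
        by simp
      finally show ?thesis
        by simp
    qed
    then show ?thesis using 1 by blast
  next
    case 2
    then show ?thesis using lin[of 0] by simp
  next
    case (3 j)
    obtain M where M: "norm (of_real s * hermite_gauss z (Suc j) s) \<le> M * exp (- (r * s\<^sup>2))" for s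
      using lin[of "Suc j"] 3 by auto
    obtain N where N: "norm (hermite_gauss z j s) \<le> N * exp (- (r * s\<^sup>2))" for s
      using less.IH[of j r] less.prems 3 by auto
    define b where "b = norm (2 * z * of_nat (Suc j))"
    have "norm (hermite_gauss z i s) \<le> (M + b * N) * exp (- (r * s\<^sup>2))" for s
    proof -
      have "norm (hermite_gauss z i s)
          \<le> norm (of_real s * hermite_gauss z (Suc j) s) + b * norm (hermite_gauss z j s)"
        unfolding 3 hermite_gauss.simps b_def norm_mult[symmetric] by (rule norm_triangle_ineq4)
      also have "\<dots> \<le> M * exp (- (r * s\<^sup>2)) + b * (N * exp (- (r * s\<^sup>2)))"
        using M[of s] N[of s] by (intro add_mono mult_left_mono) (auto simp: b_def)
      finally show ?thesis by (simp add: algebra_simps)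
    qed
    then show ?thesis by blast
  qed
qed

section \<open>Expansion of a power times the one-dimensional Gaussian\<close>

text \<open>Here \<open>i\<close> is the order of the derivative, \<open>c\<close> the power of
  \<open>y\<close>, and \<open>d\<close> the number of lowerings by the recurrence. Each lowering
  undoes one raising, so it accounts for two factors \<open>x\<close>.\<close>

definition triples :: "nat \<Rightarrow> (nat \<times> nat \<times> nat) set" where
  "triples k = {(i, d, c). i + d + d + c = k}"

lemma finite_triples: "finite (triples k)"
  by (rule finite_subset[of _ "{..k} \<times> {..k} \<times> {..k}"]) (auto simp: triples_def)

text \<open>In the induction step, multiplication by \<open>x\<close> produces each term of index \<open>(i, d, c)\<close> three times, with
  weights \<open>i\<close>, \<open>2d\<close> and \<open>c\<close>, which add up to \<open>k + 1\<close>.\<close>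

lemma power_mult_gauss_eq:
  fixes y :: complex
  assumes u: "x = of_real u + y"
  shows "x ^ k * hermite_gauss z 0 u
    = (\<Sum>(i, d, c)\<in>triples k. fact k / (fact i * fact d * fact c) * z ^ d * hermite_gauss z i u * y ^ c)"
proof -
  \<comment> \<open>Keeping \<open>k!\<close> outside the sum makes the weights independent of
    \<open>k\<close>; \<open>w1\<close> to \<open>w3\<close> then shift a single index.\<close>
  define w where "w = (\<lambda>i d c. inverse (fact i * fact d * fact c) :: complex)"
  define t where "t = (\<lambda>i d c. z ^ d * hermite_gauss z i u * y ^ c)"
  have w1: "of_nat (Suc i) * w (Suc i) d c = w i d c"
    and w2: "of_nat (Suc d) * w i (Suc d) c = w i d c"
    and w3: "of_nat (Suc c) * w i d (Suc c) = w i d c" for i d c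
    by (simp_all add: w_def field_simps del: of_nat_Suc)
  have main: "x ^ k * hermite_gauss z 0 u = fact k * (\<Sum>(i, d, c)\<in>triples k. w i d c * t i d c)" for k
  proof (induction k)
    case 0
    have "triples 0 = {(0, 0, 0)}" by (auto simp: triples_def)
    then show ?case by (simp add: w_def t_def)
  next
    case (Suc k)
    have s1: "(\<Sum>(i, d, c)\<in>triples (Suc k). of_nat i * w i d c * t i d c)
        = (\<Sum>(i, d, c)\<in>triples k. w i d c * t (Suc i) d c)" (is "sum ?f _ = sum ?h _")
    proof -
      \<comment> \<open>The factor \<open>i\<close> kills the terms with \<open>i = 0\<close>, and
        on the others lowering \<open>i\<close> is a bijection onto \<open>triples k\<close>. The
        same device serves \<open>d\<close> and \<open>c\<close> below.\<close>
      have "sum ?f (triples (Suc k)) = sum ?f {p \<in> triples (Suc k). fst p > 0}"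
        by (rule sum.mono_neutral_right) (auto simp: finite_triples)
      also have "\<dots> = (\<Sum>(i, d, c)\<in>triples k. w i d c * t (Suc i) d c)"
      proof (rule sum.reindex_bij_witness[where i = "\<lambda>(i, d, c). (Suc i, d, c)"
            and j = "\<lambda>(i, d, c). (i - 1, d, c)"])
        fix p assume "p \<in> {p \<in> triples (Suc k). fst p > 0}"
        then obtain i d c where p: "p = (Suc i, d, c)"
          by (cases p) (auto simp: gr0_conv_Suc)
        show "?h (case p of (i, d, c) \<Rightarrow> (i - 1, d, c)) = ?f p"
          unfolding p by (simp only: prod.case diff_Suc_1 w1)
      qed (auto simp: triples_def)
      finally show ?thesis .
    qed
    have s2: "(\<Sum>(i, d, c)\<in>triples (Suc k). 2 * of_nat d * w i d c * t i d c)
        = (\<Sum>(i, d, c)\<in>triples k. w i d c * (2 * z * of_nat i * t (i - 1) d c))"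
      (is "sum ?f _ = sum ?g _")
    proof -
      have "sum ?f (triples (Suc k)) = sum ?f {p \<in> triples (Suc k). fst (snd p) > 0}"
        by (rule sum.mono_neutral_right) (auto simp: finite_triples)
      also have "\<dots> = sum ?g {p \<in> triples k. fst p > 0}"
      proof (rule sum.reindex_bij_witness[where i = "\<lambda>(i, d, c). (i - 1, Suc d, c)"
            and j = "\<lambda>(i, d, c). (Suc i, d - 1, c)"])
        fix p assume "p \<in> {p \<in> triples (Suc k). fst (snd p) > 0}"
        then obtain i d c where p: "p = (i, Suc d, c)"
          by (cases p) (auto simp: gr0_conv_Suc)
        \<comment> \<open>By \<open>w1\<close> and \<open>w2\<close>, both
          \<open>Suc i * w (Suc i) d c\<close> and \<open>Suc d * w i (Suc d) c\<close> equal
          \<open>w i d c\<close>; this trades a unit of \<open>i\<close> for one of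
          \<open>d\<close>.\<close>
        have "w (Suc i) d c * (2 * z * of_nat (Suc i) * t i d c)
          = 2 * (of_nat (Suc i) * w (Suc i) d c) * (z * t i d c)"
          by (simp only: mult_ac)
        also have "\<dots> = 2 * (of_nat (Suc d) * w i (Suc d) c) * t i (Suc d) c"
          unfolding w1 w2 by (simp add: t_def)
        finally show "?g (case p of (i, d, c) \<Rightarrow> (Suc i, d - 1, c)) = ?f p"
          unfolding p by (simp only: prod.case diff_Suc_1 mult_ac)
      qed (auto simp: triples_def)
      also have "\<dots> = sum ?g (triples k)"
        by (rule sum.mono_neutral_left) (auto simp: finite_triples)
      finally show ?thesis .
    qed
    have s3: "(\<Sum>(i, d, c)\<in>triples (Suc k). of_nat c * w i d c * t i d c)
        = (\<Sum>(i, d, c)\<in>triples k. w i d c * t i d (Suc c))" (is "sum ?f _ = sum ?h _")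
    proof -
      have "sum ?f (triples (Suc k)) = sum ?f {p \<in> triples (Suc k). snd (snd p) > 0}"
        by (rule sum.mono_neutral_right) (auto simp: finite_triples)
      also have "\<dots> = (\<Sum>(i, d, c)\<in>triples k. w i d c * t i d (Suc c))"
      proof (rule sum.reindex_bij_witness[where i = "\<lambda>(i, d, c). (i, d, Suc c)"
            and j = "\<lambda>(i, d, c). (i, d, c - 1)"])
        fix p assume "p \<in> {p \<in> triples (Suc k). snd (snd p) > 0}"
        then obtain i d c where p: "p = (i, d, Suc c)"
          by (cases p) (auto simp: gr0_conv_Suc)
        show "?h (case p of (i, d, c) \<Rightarrow> (i, d, c - 1)) = ?f p"
          unfolding p by (simp only: prod.case diff_Suc_1 w3)
      qed (auto simp: triples_def)
      finally show ?thesis .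
    qed
    \<comment> \<open>In \<open>x = u + y\<close>, the factor \<open>u\<close> raises or lowers the
      Gaussian index by the recurrence, and \<open>y\<close> raises its own power.\<close>
    have step: "x * t i d c = t (Suc i) d c + 2 * z * of_nat i * t (i - 1) d c + t i d (Suc c)" for i d c
    proof -
      have "x * t i d c = z ^ d * y ^ c * (of_real u * hermite_gauss z i u) + t i d (Suc c)"
        by (simp add: u t_def algebra_simps)
      then show ?thesis
        unfolding hermite_gauss_recurrence by (simp add: t_def algebra_simps)
    qed
    have "x ^ Suc k * hermite_gauss z 0 u = fact k * (\<Sum>(i, d, c)\<in>triples k. w i d c * (x * t i d c))"
      using Suc by (simp add: sum_distrib_left case_prod_unfold mult_ac)
    also have "(\<Sum>(i, d, c)\<in>triples k. w i d c * (x * t i d c))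
      = (\<Sum>(i, d, c)\<in>triples (Suc k). of_nat i * w i d c * t i d c)
        + (\<Sum>(i, d, c)\<in>triples (Suc k). 2 * of_nat d * w i d c * t i d c)
        + (\<Sum>(i, d, c)\<in>triples (Suc k). of_nat c * w i d c * t i d c)"
      unfolding s1 s2 s3 step by (simp add: case_prod_unfold distrib_left sum.distrib)
    also have "\<dots> = (\<Sum>(i, d, c)\<in>triples (Suc k). of_nat (Suc k) * (w i d c * t i d c))"
      unfolding sum.distrib[symmetric]
    proof (rule sum.cong)
      fix p assume "p \<in> triples (Suc k)"
      then obtain i d c where p: "p = (i, d, c)" "Suc k = i + d + d + c"
        by (auto simp: triples_def)
      show "(case p of (i, d, c) \<Rightarrow> of_nat i * w i d c * t i d c)
          + (case p of (i, d, c) \<Rightarrow> 2 * of_nat d * w i d c * t i d c)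
          + (case p of (i, d, c) \<Rightarrow> of_nat c * w i d c * t i d c)
        = (case p of (i, d, c) \<Rightarrow> of_nat (Suc k) * (w i d c * t i d c))"
        unfolding p by (simp add: algebra_simps)
    qed simp
    finally show ?case
      by (simp add: sum_distrib_left case_prod_unfold mult_ac)
  qed
  show ?thesis
    unfolding main by (simp add: w_def t_def sum_distrib_left case_prod_unfold divide_inverse mult_ac)
qed

section \<open>Derivatives of the heat kernel\<close>

text \<open>\<open>gauss_kernel z \<beta>\<close> is \<open>(-2z\<partial>)\<^sup>\<beta> G\<^sub>z\<close>.\<close>

definition gauss_kernel :: "complex \<Rightarrow> nat^'n \<Rightarrow> real^'n \<Rightarrow> complex" where
  "gauss_kernel z \<beta> x =
     (4 * of_real pi * z) powr (- (of_nat CARD('n) / 2)) * (\<Prod>j\<in>UNIV. hermite_gauss z (\<beta> $ j) (x $ j))"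

lemma gauss_eq_gauss_kernel: "gauss z = gauss_kernel z 0"
proof
  fix x :: "real^'n"
  have "exp (- (of_real ((norm x)\<^sup>2) / (4 * z))) = (\<Prod>j\<in>UNIV. hermite_gauss z 0 (x $ j))"
    by (simp add: norm_vec_power2 sum_divide_distrib flip: exp_sum sum_negf)
  then show "gauss z x = gauss_kernel z 0 x"
    by (simp add: gauss_def gauss_kernel_def)
qed

lemma borel_measurable_gauss_kernel [measurable]:
  assumes "z \<noteq> 0"
  shows "gauss_kernel z \<beta> \<in> borel_measurable borel"
proof -
  have "continuous_on UNIV (hermite_gauss z k)" for k
    using has_vector_derivative_hermite_gauss[OF assms]
    by (intro continuous_at_imp_continuous_on ballI has_vector_derivative_continuous)
  then have [measurable]: "hermite_gauss z k \<in> borel_measurable borel" for k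
    by (rule borel_measurable_continuous_onI)
  show ?thesis
    unfolding gauss_kernel_def[abs_def] by measurable
qed

text \<open>The coordinate bounds multiply. Rate \<open>r = 0\<close> later gives boundedness, a
  positive rate integrability.\<close>

lemma norm_gauss_kernel_le:
  fixes \<beta> :: "nat^'n"
  assumes "r < Re (1 / (4 * z))"
  shows "\<exists>M\<ge>0. \<forall>x. norm (gauss_kernel z \<beta> x) \<le> M * exp (- (r * (norm x)\<^sup>2))"
proof -
  obtain M where M: "norm (hermite_gauss z k s) \<le> M k * exp (- (r * s\<^sup>2))" for k s
    using norm_hermite_gauss_le[OF assms] by metis
  have M0: "0 \<le> M k" for k
    using order_trans[OF norm_ge_zero M[of k 0]] by simp
  define A where "A = norm ((4 * of_real pi * z) powr (- (of_nat CARD('n) / 2)))"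
  have "norm (gauss_kernel z \<beta> x) \<le> A * (\<Prod>j\<in>UNIV. M (\<beta> $ j)) * exp (- (r * (norm x)\<^sup>2))" for x
  proof -
    have "norm (gauss_kernel z \<beta> x) = A * (\<Prod>j\<in>UNIV. norm (hermite_gauss z (\<beta> $ j) (x $ j)))"
      by (simp add: gauss_kernel_def norm_mult A_def prod_norm)
    also have "\<dots> \<le> A * (\<Prod>j\<in>UNIV. M (\<beta> $ j) * exp (- (r * (x $ j)\<^sup>2)))"
      by (intro mult_left_mono prod_mono) (auto simp: M A_def)
    also have "\<dots> = A * (\<Prod>j\<in>UNIV. M (\<beta> $ j)) * exp (- (r * (norm x)\<^sup>2))"
      by (simp add: norm_vec_power2 prod.distrib sum_distrib_left flip: exp_sum sum_negf)
    finally show ?thesis .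
  qed
  then show ?thesis
    using M0 by (intro exI[of _ "A * (\<Prod>j\<in>UNIV. M (\<beta> $ j))"]) (auto simp: A_def prod_nonneg)
qed

text \<open>Inversion preserves the right half-plane; this leaves room for a positive decay
  rate.\<close>

lemma Re_inverse_pos:
  assumes "Re z > 0"
  shows "Re (1 / (4 * z)) > 0"
  using assms by (simp add: Re_divide complex_neq_0 add_pos_nonneg)

lemma bounded_gauss_kernel:
  assumes "Re z > 0"
  shows "\<exists>M. \<forall>x. norm (gauss_kernel z \<beta> x) \<le> M"
  using norm_gauss_kernel_le[OF Re_inverse_pos[OF assms], of \<beta>] by auto

lemma integrable_gauss_kernel:
  fixes \<beta> :: "nat^'n"
  assumes "Re z > 0"
  shows "integrable lborel (gauss_kernel z \<beta>)"
proof -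
  have "z \<noteq> 0" using assms by auto
  obtain r where r: "0 < r" "r < Re (1 / (4 * z))"
    using dense[OF Re_inverse_pos[OF assms]] by blast
  obtain M where "M \<ge> 0" and M: "norm (gauss_kernel z \<beta> x) \<le> M * exp (- (r * (norm x)\<^sup>2))" for x
    using norm_gauss_kernel_le[OF r(2)] by blast
  have "integrable lborel (\<lambda>x :: real^'n. M * exp (- (r * (norm x)\<^sup>2)))"
    using integrable_exp_neg_norm_square[OF r(1)] by (intro integrable_mult_right)
  then show ?thesis
    by (rule Bochner_Integration.integrable_bound)
      (use \<open>z \<noteq> 0\<close> M \<open>M \<ge> 0\<close> in \<open>auto simp: abs_mult\<close>)
qed

lemma has_vector_derivative_gauss_kernel:
  fixes \<beta> :: "nat^'n"
  assumes "z \<noteq> 0"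
  shows "((\<lambda>s. gauss_kernel z \<beta> (x + s *\<^sub>R axis j 1)) has_vector_derivative
    - 1 / (2 * z) * gauss_kernel z (\<beta> + axis j 1) x) (at 0)"
proof -
  define A where "A = (4 * of_real pi * z) powr (- (of_nat CARD('n) / 2))
    * (\<Prod>i\<in>UNIV - {j}. hermite_gauss z (\<beta> $ i) (x $ i))"
  \<comment> \<open>Only the factor at \<open>j\<close> depends on \<open>s\<close>, and
    \<open>A\<close> collects the rest. Allowing any \<open>\<beta>'\<close> that agrees with
    \<open>\<beta>\<close> off \<open>j\<close> covers both \<open>\<beta>\<close> and
    \<open>\<beta> + axis j 1\<close>.\<close>
  have split: "gauss_kernel z \<beta>' (x + s *\<^sub>R axis j 1) = A * hermite_gauss z (\<beta>' $ j) (s + x $ j)"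
    if "\<And>i. i \<noteq> j \<Longrightarrow> \<beta>' $ i = \<beta> $ i" for \<beta>' s
  proof -
    have "(\<Prod>i\<in>UNIV - {j}. hermite_gauss z (\<beta>' $ i) ((x + s *\<^sub>R axis j 1) $ i))
        = (\<Prod>i\<in>UNIV - {j}. hermite_gauss z (\<beta> $ i) (x $ i))"
      using that by (intro prod.cong) (auto simp: axis_def)
    then show ?thesis
      unfolding gauss_kernel_def A_def
      by (subst prod.remove[of UNIV j]) (auto simp: axis_def add.commute)
  qed
  have "((\<lambda>s. hermite_gauss z (\<beta> $ j) (s + x $ j)) has_vector_derivative
      - hermite_gauss z (Suc (\<beta> $ j)) (0 + x $ j) / (2 * z)) (at 0)"
    using has_vector_derivative_hermite_gauss[OF assms, of "\<beta> $ j" "x $ j"]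
    by (simp add: has_vector_derivative_iff_tendsto add.commute)
  then have "((\<lambda>s. A * hermite_gauss z (\<beta> $ j) (s + x $ j)) has_vector_derivative
      A * (- hermite_gauss z (Suc (\<beta> $ j)) (0 + x $ j) / (2 * z))) (at 0)"
    by (rule has_vector_derivative_mult_right)
  moreover have "(\<lambda>s. A * hermite_gauss z (\<beta> $ j) (s + x $ j)) = (\<lambda>s. gauss_kernel z \<beta> (x + s *\<^sub>R axis j 1))"
    by (simp add: split)
  moreover have "A * (- hermite_gauss z (Suc (\<beta> $ j)) (0 + x $ j) / (2 * z))
      = - 1 / (2 * z) * gauss_kernel z (\<beta> + axis j 1) x"
    using split[of "\<beta> + axis j 1" 0] by (simp add: axis_def)
  ultimately show ?thesis by (simp only:)
qed

section \<open>Derivatives of the heat semigroup\<close>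

text \<open>The scalar \<open>a\<close> is carried along so that the family of such convolutions is
  closed under \<open>partial_deriv j\<close> and the formula can be iterated.\<close>

lemma partial_deriv_gauss_kernel_convolution:
  fixes \<psi> :: "real^'n \<Rightarrow> complex"
  assumes z: "Re z > 0" and \<psi>: "\<psi> \<in> L1"
  shows "partial_deriv j (convolution (\<lambda>x. a * gauss_kernel z \<beta> x) \<psi>)
    = convolution (\<lambda>x. a * (- 1 / (2 * z)) * gauss_kernel z (\<beta> + axis j 1) x) \<psi>"
proof -
  have [simp]: "z \<noteq> 0" using z by auto
  obtain A where A: "norm (gauss_kernel z \<beta> x) \<le> A" for x :: "real^'n"
    using bounded_gauss_kernel[OF z] by blast
  obtain B where B: "norm (gauss_kernel z (\<beta> + axis j 1) x) \<le> B" for x :: "real^'n"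
    using bounded_gauss_kernel[OF z] by blast
  show ?thesis
  proof (rule partial_deriv_convolution[OF _ _ _ _ _ \<psi>])
    show "norm (a * gauss_kernel z \<beta> x) \<le> norm a * A" for x
      unfolding norm_mult by (intro mult_left_mono A) auto
    show "norm (a * (- 1 / (2 * z)) * gauss_kernel z (\<beta> + axis j 1) x) \<le> norm (a * (- 1 / (2 * z))) * B" for x
      unfolding norm_mult[of "a * (- 1 / (2 * z))"] by (intro mult_left_mono B) auto
    show "((\<lambda>s. a * gauss_kernel z \<beta> (x + s *\<^sub>R axis j 1)) has_vector_derivative
        a * (- 1 / (2 * z)) * gauss_kernel z (\<beta> + axis j 1) x) (at 0)" for x
      unfolding mult.assoc[of a]
      by (intro has_vector_derivative_mult_right has_vector_derivative_gauss_kernel) simp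
  qed simp_all
qed

lemma partial_deriv_power_gauss_kernel_convolution:
  fixes \<psi> :: "real^'n \<Rightarrow> complex"
  assumes "Re z > 0" and "\<psi> \<in> L1"
  shows "(partial_deriv j ^^ n) (convolution (\<lambda>x. a * gauss_kernel z \<beta> x) \<psi>)
    = convolution (\<lambda>x. a * (- 1 / (2 * z)) ^ n * gauss_kernel z (\<beta> + axis j n) x) \<psi>"
proof (induction n)
  case 0
  have *: "axis j 0 = (0 :: nat^'n)" by (simp add: axis_def vec_eq_iff)
  show ?case by (simp add: *)
next
  case (Suc n)
  have "\<beta> + axis j n + axis j 1 = \<beta> + axis j (Suc n)"
    by (simp add: axis_def vec_eq_iff)
  moreover have "(partial_deriv j ^^ Suc n) (convolution (\<lambda>x. a * gauss_kernel z \<beta> x) \<psi>)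
      = partial_deriv j (convolution (\<lambda>x. a * (- 1 / (2 * z)) ^ n * gauss_kernel z (\<beta> + axis j n) x) \<psi>)"
    using Suc by simp
  ultimately show ?case
    by (simp only: partial_deriv_gauss_kernel_convolution[OF assms] power_Suc2 mult.assoc[symmetric])
qed

lemma set_coords: "set (coords :: 'n::finite list) = UNIV" and distinct_coords: "distinct (coords :: 'n list)"
proof -
  have "\<exists>js :: 'n list. set js = UNIV \<and> distinct js"
    using finite_distinct_list[OF finite] by blast
  then have "set (coords :: 'n list) = UNIV \<and> distinct (coords :: 'n list)"
    unfolding coords_def by (rule someI_ex)
  then show "set (coords :: 'n list) = UNIV" "distinct (coords :: 'n list)" by auto
qed

lemma multi_deriv_heat:
  fixes \<psi> :: "real^'n \<Rightarrow> complex"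
  assumes z: "Re z > 0" and \<psi>: "\<psi> \<in> L1"
  shows "multi_deriv \<beta> (heat z \<psi>) = (\<lambda>x. (- 1 / (2 * z)) ^ mi_abs \<beta> * convolution (gauss_kernel z \<beta>) \<psi> x)"
proof -
  define w where "w = - 1 / (2 * z)"
  \<comment> \<open>Induction over arbitrary distinct lists: the kernel index is
    \<open>\<beta>\<close> restricted to the coordinates already treated, and distinctness ensures
    that each is added once.\<close>
  have "foldr (\<lambda>j. partial_deriv j ^^ (\<beta> $ j)) js (heat z \<psi>)
    = convolution (\<lambda>x. w ^ (\<Sum>j\<in>set js. \<beta> $ j)
        * gauss_kernel z (\<chi> j. if j \<in> set js then \<beta> $ j else 0) x) \<psi>" if "distinct js" for js
    using that
  proof (induction js)
    case Nil
    have "(\<chi> j. 0) = (0 :: nat^'n)" by (simp add: vec_eq_iff)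
    then show ?case by (simp add: heat_def gauss_eq_gauss_kernel)
  next
    case (Cons i js)
    have "foldr (\<lambda>j. partial_deriv j ^^ (\<beta> $ j)) (i # js) (heat z \<psi>)
      = (partial_deriv i ^^ (\<beta> $ i)) (convolution (\<lambda>x. w ^ (\<Sum>j\<in>set js. \<beta> $ j)
          * gauss_kernel z (\<chi> j. if j \<in> set js then \<beta> $ j else 0) x) \<psi>)"
      using Cons by simp
    also have "\<dots> = convolution (\<lambda>x. w ^ (\<Sum>j\<in>set js. \<beta> $ j) * w ^ (\<beta> $ i)
        * gauss_kernel z ((\<chi> j. if j \<in> set js then \<beta> $ j else 0) + axis i (\<beta> $ i)) x) \<psi>"
      unfolding w_def by (rule partial_deriv_power_gauss_kernel_convolution[OF assms])
    also have "w ^ (\<Sum>j\<in>set js. \<beta> $ j) * w ^ (\<beta> $ i) = w ^ (\<Sum>j\<in>set (i # js). \<beta> $ j)"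
      using Cons.prems by (simp add: power_add mult.commute)
    also have "(\<chi> j. if j \<in> set js then \<beta> $ j else 0) + axis i (\<beta> $ i)
        = (\<chi> j. if j \<in> set (i # js) then \<beta> $ j else 0)"
      using Cons.prems by (auto simp: vec_eq_iff axis_def)
    finally show ?case .
  qed
  from this[OF distinct_coords] show ?thesis
    by (simp add: multi_deriv_def set_coords mi_abs_def convolution_def mult.assoc w_def)
qed

section \<open>Expansion of a monomial times the heat kernel\<close>

definition mi_triples :: "nat^'n \<Rightarrow> ((nat^'n) \<times> (nat^'n) \<times> (nat^'n)) set" where
  "mi_triples \<alpha> = {(\<beta>, \<delta>, \<gamma>). \<beta> + \<delta> + \<delta> + \<gamma> = \<alpha>}"

lemma finite_mi_triples: "finite (mi_triples \<alpha>)"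
proof (rule finite_subset)
  show "mi_triples \<alpha> \<subseteq> {\<beta>. \<beta> \<le> \<alpha>} \<times> {\<beta>. \<beta> \<le> \<alpha>} \<times> {\<beta>. \<beta> \<le> \<alpha>}"
    by (auto simp: mi_triples_def less_eq_vec_def)
qed (intro finite_SigmaI finite_mi_atMost)

text \<open>The one-variable expansion is applied in each coordinate with
  \<open>u = (x - y) $ j\<close>. The product of sums becomes a sum over choices of one triple per
  coordinate, and these correspond to triples of multi-indices.\<close>

lemma monomial_mult_gauss_eq:
  fixes \<alpha> :: "nat^'n"
  shows "of_real (monomial \<alpha> x) * gauss z (x - y)
    = (\<Sum>(\<beta>, \<delta>, \<gamma>)\<in>mi_triples \<alpha>. of_nat (mi_fact \<alpha>) / of_nat (mi_fact \<beta> * mi_fact \<delta> * mi_fact \<gamma>)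
        * z ^ mi_abs \<delta> * (gauss_kernel z \<beta> (x - y) * of_real (monomial \<gamma> y)))"
  (is "_ = sum ?F _")
proof -
  define c where "c = (4 * of_real pi * z) powr (- (of_nat CARD('n) / 2))"
  define T where "T = (\<lambda>j (i, d, e). fact (\<alpha> $ j) / (fact i * fact d * fact e) * z ^ d
      * hermite_gauss z i ((x - y) $ j) * of_real (y $ j) ^ e)"
  \<comment> \<open>Transposes a family of triples indexed by coordinates into a triple of
    vectors.\<close>
  define h where "h = (\<lambda>f. ((\<chi> j. fst (f j)) :: nat^'n, (\<chi> j. fst (snd (f j))) :: nat^'n,
      (\<chi> j. snd (snd (f j))) :: nat^'n))"
  have "of_real (monomial \<alpha> x) * gauss z (x - y)
      = c * (\<Prod>j\<in>UNIV. of_real (x $ j) ^ (\<alpha> $ j) * hermite_gauss z 0 ((x - y) $ j))"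
    by (simp add: gauss_eq_gauss_kernel gauss_kernel_def monomial_def c_def prod.distrib)
  also have "(\<Prod>j\<in>UNIV. of_real (x $ j) ^ (\<alpha> $ j) * hermite_gauss z 0 ((x - y) $ j))
      = (\<Prod>j\<in>UNIV. \<Sum>p\<in>triples (\<alpha> $ j). T j p)"
    unfolding T_def by (intro prod.cong refl power_mult_gauss_eq) simp
  also have "\<dots> = (\<Sum>f\<in>PiE UNIV (\<lambda>j. triples (\<alpha> $ j)). \<Prod>j\<in>UNIV. T j (f j))"
    by (intro prod_sum_PiE finite_triples) simp
  also have "c * \<dots> = (\<Sum>f\<in>PiE UNIV (\<lambda>j. triples (\<alpha> $ j)). c * (\<Prod>j\<in>UNIV. T j (f j)))"
    by (rule sum_distrib_left)
  also have "\<dots> = sum ?F (mi_triples \<alpha>)"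
  proof (rule sum.reindex_bij_witness[where j = h and i = "\<lambda>(\<beta>, \<delta>, \<gamma>) j. (\<beta> $ j, \<delta> $ j, \<gamma> $ j)"])
    fix f assume "f \<in> PiE UNIV (\<lambda>j. triples (\<alpha> $ j))"
    show "?F (h f) = c * (\<Prod>j\<in>UNIV. T j (f j))"
      by (simp add: h_def T_def case_prod_unfold prod.distrib prod_dividef gauss_kernel_def c_def
          mi_fact_def mi_abs_def monomial_def power_sum mult_ac)
  qed (auto simp: h_def mi_triples_def triples_def vec_eq_iff PiE_UNIV_domain Pi_iff case_prod_unfold)
  finally show ?thesis .
qed

section \<open>The commutator\<close>

lemma mi_abs_0 [simp]: "mi_abs 0 = 0"
  and mi_abs_add: "mi_abs (\<beta> + \<gamma>) = mi_abs \<beta> + mi_abs \<gamma>"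
  and mi_abs_eq_0_iff: "mi_abs \<beta> = 0 \<longleftrightarrow> \<beta> = 0"
  by (simp_all add: mi_abs_def sum.distrib vec_eq_iff)

lemma mi_fact_0 [simp]: "mi_fact 0 = 1"
  and mi_fact_nonzero [simp]: "mi_fact \<beta> \<noteq> 0"
  by (simp_all add: mi_fact_def)

lemma heat_in_L1:
  assumes "Re z > 0" and "\<psi> \<in> L1"
  shows "multi_deriv \<beta> (heat z \<psi>) \<in> L1" "heat z \<psi> \<in> L1"
proof -
  have "z \<noteq> 0" using assms(1) by auto
  then have conv: "convolution (gauss_kernel z \<beta>) \<psi> \<in> L1" for \<beta>
    using assms by (intro convolution_in_L1 integrable_gauss_kernel borel_measurable_gauss_kernel)
  then show "heat z \<psi> \<in> L1"
    by (simp add: heat_def gauss_eq_gauss_kernel)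
  show "multi_deriv \<beta> (heat z \<psi>) \<in> L1"
    unfolding multi_deriv_heat[OF assms] using conv by (simp add: L1_def)
qed

text \<open>The kernel identity is multiplied by \<open>\<phi> y\<close> and integrated. Each
  summand is integrable, since its kernel is bounded and \<open>\<gamma>\<close> has order at most
  \<open>mi_abs \<alpha>\<close>, so sum and integral commute at every \<open>x\<close>.\<close>

lemma monomial_mult_heat_eq:
  fixes \<alpha> :: "nat^'n"
  assumes z: "Re z > 0" and \<phi>: "\<phi> \<in> L1_weighted (mi_abs \<alpha>)"
  shows "mult_monomial \<alpha> (heat z \<phi>) x
    = (\<Sum>(\<beta>, \<delta>, \<gamma>)\<in>mi_triples \<alpha>. of_nat (mi_fact \<alpha>) / of_nat (mi_fact \<beta> * mi_fact \<delta> * mi_fact \<gamma>)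
        * (- 2) ^ mi_abs \<beta> * z ^ (mi_abs \<beta> + mi_abs \<delta>)
        * multi_deriv \<beta> (heat z (mult_monomial \<gamma> \<phi>)) x)"
proof -
  have z0: "z \<noteq> 0" using z by auto
  have L1: "mult_monomial \<gamma> \<phi> \<in> L1" if "(\<beta>, \<delta>, \<gamma>) \<in> mi_triples \<alpha>" for \<beta> \<delta> \<gamma>
    using \<phi> that by (auto simp: L1_weighted_def mi_triples_def mi_abs_add)
  define a where "a = (\<lambda>(\<beta> :: nat^'n) (\<delta> :: nat^'n) (\<gamma> :: nat^'n).
    of_nat (mi_fact \<alpha>) / of_nat (mi_fact \<beta> * mi_fact \<delta> * mi_fact \<gamma>) :: complex)"
  have int: "integrable lebesgue (\<lambda>y. gauss_kernel z \<beta> (x - y) * mult_monomial \<gamma> \<phi> y)"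
    if "(\<beta>, \<delta>, \<gamma>) \<in> mi_triples \<alpha>" for \<beta> \<delta> \<gamma>
    using bounded_gauss_kernel[OF z, of \<beta>] integrable_convolution_integrand[OF _ _ L1[OF that]]
      borel_measurable_gauss_kernel[OF z0] by blast
  have "mult_monomial \<alpha> (heat z \<phi>) x = (\<integral>y. of_real (monomial \<alpha> x) * gauss z (x - y) * \<phi> y \<partial>lebesgue)"
    by (simp add: mult_monomial_def heat_def convolution_def mult.assoc)
  also have "\<dots> = (\<integral>y. (\<Sum>(\<beta>, \<delta>, \<gamma>)\<in>mi_triples \<alpha>. a \<beta> \<delta> \<gamma> * z ^ mi_abs \<delta>
      * (gauss_kernel z \<beta> (x - y) * mult_monomial \<gamma> \<phi> y)) \<partial>lebesgue)"
    unfolding monomial_mult_gauss_eq a_def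
    by (simp add: sum_distrib_right case_prod_unfold mult_monomial_def mult.assoc)
  also have "\<dots> = (\<Sum>(\<beta>, \<delta>, \<gamma>)\<in>mi_triples \<alpha>. \<integral>y. a \<beta> \<delta> \<gamma> * z ^ mi_abs \<delta>
      * (gauss_kernel z \<beta> (x - y) * mult_monomial \<gamma> \<phi> y) \<partial>lebesgue)"
    unfolding case_prod_unfold
    by (intro Bochner_Integration.integral_sum integrable_mult_right) (auto intro: int)
  also have "\<dots> = (\<Sum>(\<beta>, \<delta>, \<gamma>)\<in>mi_triples \<alpha>. a \<beta> \<delta> \<gamma> * (- 2) ^ mi_abs \<beta> * z ^ (mi_abs \<beta> + mi_abs \<delta>)
        * multi_deriv \<beta> (heat z (mult_monomial \<gamma> \<phi>)) x)"
  proof (rule sum.cong[OF refl], clarify)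
    fix \<beta> \<delta> \<gamma> assume "(\<beta>, \<delta>, \<gamma>) \<in> mi_triples \<alpha>"
    \<comment> \<open>The powers of \<open>-2z\<close> cancel the factors \<open>-1 / (2z)\<close>
      from \<open>multi_deriv_heat\<close>, which turns convolutions with
      \<open>gauss_kernel\<close> into derivatives of \<open>heat\<close>.\<close>
    have "(- 2) ^ k * z ^ k * (- 1 / (2 * z)) ^ k = 1" for k
      using z0 by (simp flip: power_mult_distrib)
    then have cancel: "w = (- 2) ^ k * z ^ k * ((- 1 / (2 * z)) ^ k * w)" for k w
      by (metis mult.assoc mult_1)
    have "(\<integral>y. a \<beta> \<delta> \<gamma> * z ^ mi_abs \<delta> * (gauss_kernel z \<beta> (x - y) * mult_monomial \<gamma> \<phi> y) \<partial>lebesgue)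
      = a \<beta> \<delta> \<gamma> * z ^ mi_abs \<delta> * convolution (gauss_kernel z \<beta>) (mult_monomial \<gamma> \<phi>) x"
      unfolding convolution_def by (rule integral_mult_right_zero)
    also have "\<dots> = a \<beta> \<delta> \<gamma> * z ^ mi_abs \<delta> * ((- 2) ^ mi_abs \<beta> * z ^ mi_abs \<beta>
        * multi_deriv \<beta> (heat z (mult_monomial \<gamma> \<phi>)) x)"
      unfolding multi_deriv_heat[OF z L1[OF \<open>(\<beta>, \<delta>, \<gamma>) \<in> mi_triples \<alpha>\<close>]] cancel[symmetric] ..
    finally show "(\<integral>y. a \<beta> \<delta> \<gamma> * z ^ mi_abs \<delta> * (gauss_kernel z \<beta> (x - y) * mult_monomial \<gamma> \<phi> y) \<partial>lebesgue)
      = a \<beta> \<delta> \<gamma> * (- 2) ^ mi_abs \<beta> * z ^ (mi_abs \<beta> + mi_abs \<delta>)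
        * multi_deriv \<beta> (heat z (mult_monomial \<gamma> \<phi>)) x"
      by (simp only: power_add mult_ac)
  qed
  finally show ?thesis
    unfolding a_def .
qed

theorem theorem2p5:
  fixes m :: nat and \<alpha> :: "nat^'n"
  assumes "m > 0" and "mi_abs \<alpha> = m"
  shows "\<exists>C :: nat \<Rightarrow> nat^'n \<Rightarrow> nat^'n \<Rightarrow> real.
    \<forall>\<nu> :: complex. Re \<nu> > 0 \<longrightarrow>
      (\<forall>\<phi> \<in> L1_weighted m. \<forall>t :: real. t > 0 \<longrightarrow>
        mult_monomial \<alpha> (heat (of_real t * \<nu>) \<phi>) \<in> L1 \<and>
        eq_in_L1 (commutator (mult_monomial \<alpha>) (heat (of_real t * \<nu>)) \<phi>)
                 (remainder C \<alpha> \<nu> t \<phi>))"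
proof -
  \<comment> \<open>\<open>A\<close> and \<open>B\<close> supply the first and second sum; the only
    triple left is \<open>(0, 0, \<alpha>)\<close>.\<close>
  define A where "A = {(\<beta>, \<delta>, \<gamma>) \<in> mi_triples \<alpha>. \<delta> = 0 \<and> \<beta> \<noteq> 0}"
  define B where "B = {(\<beta>, \<delta>, \<gamma>) \<in> mi_triples \<alpha>. \<delta> \<noteq> 0}"
  define g where "g = (\<lambda>(\<beta> :: nat^'n, \<delta> :: nat^'n, \<gamma> :: nat^'n). (mi_abs \<beta> + mi_abs \<delta>, \<beta>, \<gamma>))"
  define a where "a = (\<lambda>(\<beta> :: nat^'n) (\<delta> :: nat^'n) (\<gamma> :: nat^'n).
    of_nat (mi_fact \<alpha>) / of_nat (mi_fact \<beta> * mi_fact \<delta> * mi_fact \<gamma>) * (- 2) ^ mi_abs \<beta> :: real)"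
  \<comment> \<open>The equation \<open>\<beta> + \<delta> + \<delta> + \<gamma> = \<alpha>\<close>
    determines \<open>\<delta>\<close>, so this sum has at most one term; it is \<open>0\<close>
    when no \<open>\<delta>\<close> fits. Only \<open>\<alpha>\<close> enters besides the three
    arguments.\<close>
  define C where "C = (\<lambda>l \<beta> \<gamma>. \<Sum>(\<beta>, \<delta>, \<gamma>)\<in>{p \<in> B. g p = (l, \<beta>, \<gamma>)}. a \<beta> \<delta> \<gamma>)"
  have fin: "finite A" "finite B"
    by (rule finite_subset[OF _ finite_mi_triples[of \<alpha>]]; auto simp: A_def B_def)+
  have triples: "mi_triples \<alpha> = insert (0, 0, \<alpha>) (A \<union> B)" "(0, 0, \<alpha>) \<notin> A \<union> B" "A \<inter> B = {}"
    by (auto simp: A_def B_def mi_triples_def)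
  \<comment> \<open>With \<open>l = mi_abs \<beta> + mi_abs \<delta>\<close>, the upper bound on
    \<open>l\<close> holds with equality; the lower bound and the drop of the order by
    \<open>2\<close> express \<open>\<delta> \<noteq> 0\<close>.\<close>
  have g: "g ` B \<subseteq> remainder_indices \<alpha>"
  proof
    fix q assume "q \<in> g ` B"
    then obtain \<beta> \<delta> \<gamma> where q: "q = (mi_abs \<beta> + mi_abs \<delta>, \<beta>, \<gamma>)" "\<delta> \<noteq> 0" "\<beta> + \<delta> + \<delta> + \<gamma> = \<alpha>"
      by (auto simp: g_def B_def mi_triples_def)
    have "mi_abs \<delta> \<noteq> 0" using q(2) by (simp add: mi_abs_eq_0_iff)
    moreover have "mi_abs \<alpha> = mi_abs \<beta> + 2 * mi_abs \<delta> + mi_abs \<gamma>"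
      using q(3) by (auto simp: mi_abs_add)
    moreover have "\<beta> + \<gamma> \<le> \<alpha>"
      using q(3) by (auto simp: less_eq_vec_def)
    ultimately show "q \<in> remainder_indices \<alpha>"
      by (simp add: q(1) remainder_indices_def mi_abs_add)
  qed
  have "mult_monomial \<alpha> (heat (of_real t * \<nu>) \<phi>) \<in> L1 \<and>
        eq_in_L1 (commutator (mult_monomial \<alpha>) (heat (of_real t * \<nu>)) \<phi>) (remainder C \<alpha> \<nu> t \<phi>)"
    if "Re \<nu> > 0" and \<phi>: "\<phi> \<in> L1_weighted m" and "t > 0" for \<nu> \<phi> and t :: real
  proof -
    define z where "z = of_real t * \<nu>"
    have z: "Re z > 0" using that by (simp add: z_def)
    define D where "D = (\<lambda>\<beta> \<gamma>. multi_deriv \<beta> (heat z (mult_monomial \<gamma> \<phi>)))"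
    have L1: "mult_monomial \<gamma> \<phi> \<in> L1" if "mi_abs \<gamma> \<le> m" for \<gamma>
      using \<phi> that by (simp add: L1_weighted_def)
    have D_L1: "integrable lebesgue (D \<beta> \<gamma>)" if "mi_abs \<gamma> \<le> m" for \<beta> \<gamma>
      using heat_in_L1(1)[OF z L1[OF that]] by (simp add: D_def L1_def)
    define h where "h = (\<lambda>x (\<beta>, \<delta>, \<gamma>). of_real (a \<beta> \<delta> \<gamma>) * z ^ (mi_abs \<beta> + mi_abs \<delta>) * D \<beta> \<gamma> x)"
    have expand: "mult_monomial \<alpha> (heat z \<phi>) x = (\<Sum>p\<in>mi_triples \<alpha>. h x p)" for x
      using monomial_mult_heat_eq[OF z, of \<phi> \<alpha> x] \<phi> assms(2)
      by (simp add: h_def a_def D_def case_prod_unfold)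
    \<comment> \<open>The leftover term is exactly the one that the commutator subtracts.\<close>
    have main: "h x (0, 0, \<alpha>) = heat z (mult_monomial \<alpha> \<phi>) x" for x
    proof -
      have "multi_deriv 0 f = f" for f :: "real^'n \<Rightarrow> complex"
      proof -
        have "foldr (\<lambda>j. partial_deriv j ^^ (0 :: nat^'n) $ j) js f = f" for js
          by (induction js) simp_all
        then show ?thesis by (simp add: multi_deriv_def)
      qed
      then show ?thesis by (simp add: h_def a_def D_def)
    qed
    have sumA: "sum (h x) A = (\<Sum>(\<beta>, \<gamma>)\<in>{(\<beta>, \<gamma>). \<beta> + \<gamma> = \<alpha> \<and> \<beta> \<noteq> 0}.
        of_nat (mi_fact \<alpha>) / of_nat (mi_fact \<beta> * mi_fact \<gamma>)
        * ((- 2 * of_real t * \<nu>) ^ mi_abs \<beta> * D \<beta> \<gamma> x))" for x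
    proof (rule sum.reindex_bij_witness[where i = "\<lambda>(\<beta>, \<gamma>). (\<beta>, 0, \<gamma>)" and j = "\<lambda>(\<beta>, \<delta>, \<gamma>). (\<beta>, \<gamma>)"])
      have "(- 2 * of_real t * \<nu>) ^ k = (- 2) ^ k * z ^ k" for k
        by (simp add: z_def mult.assoc flip: power_mult_distrib)
      then show "(case case p of (\<beta>, \<delta>, \<gamma>) \<Rightarrow> (\<beta>, \<gamma>) of (\<beta>, \<gamma>) \<Rightarrow>
          of_nat (mi_fact \<alpha>) / of_nat (mi_fact \<beta> * mi_fact \<gamma>)
          * ((- 2 * of_real t * \<nu>) ^ mi_abs \<beta> * D \<beta> \<gamma> x)) = h x p" if "p \<in> A" for p
        using that by (auto simp: A_def h_def a_def)
    qed (auto simp: A_def mi_triples_def)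
    have sumB: "sum (h x) B = (\<Sum>(l, \<beta>, \<gamma>)\<in>remainder_indices \<alpha>.
        of_real (C l \<beta> \<gamma>) * (of_real t * \<nu>) ^ l * D \<beta> \<gamma> x)" for x
    proof -
      \<comment> \<open>Regrouping by the fibres of \<open>g\<close>: on each fibre the power of
        \<open>z\<close> and the derivative term are constant, and the coefficients add up to
        \<open>C\<close>.\<close>
      have "sum (h x) B = (\<Sum>q\<in>remainder_indices \<alpha>. sum (h x) {p \<in> B. g p = q})"
        by (rule sum.group[OF fin(2) finite_remainder_indices g, symmetric])
      also have "\<dots> = (\<Sum>(l, \<beta>, \<gamma>)\<in>remainder_indices \<alpha>. of_real (C l \<beta> \<gamma>) * z ^ l * D \<beta> \<gamma> x)"
      proof (rule sum.cong[OF refl], clarify)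
        fix l \<beta> \<gamma>
        show "sum (h x) {p \<in> B. g p = (l, \<beta>, \<gamma>)} = of_real (C l \<beta> \<gamma>) * z ^ l * D \<beta> \<gamma> x"
          unfolding C_def of_real_sum sum_distrib_right
          by (rule sum.cong) (auto simp: h_def g_def)
      qed
      finally show ?thesis by (simp add: z_def)
    qed
    have comm: "commutator (mult_monomial \<alpha>) (heat z) \<phi> x = remainder C \<alpha> \<nu> t \<phi> x" for x
    proof -
      have "commutator (mult_monomial \<alpha>) (heat z) \<phi> x = sum (h x) A + sum (h x) B"
        unfolding commutator_def expand triples(1)
        using fin triples(2,3) by (simp add: sum.union_disjoint main)
      then show ?thesis
        unfolding sumA sumB by (simp add: remainder_def D_def z_def)
    qed
    \<comment> \<open>Integrability of \<open>mult_monomial \<alpha> (heat z \<phi>)\<close> is read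
      off the expansion, whose finitely many terms are integrable.\<close>
    have "integrable lebesgue (\<lambda>x. h x p)" if "p \<in> mi_triples \<alpha>" for p
      using that assms(2) by (auto simp: h_def mi_triples_def mi_abs_add intro!: integrable_mult_right D_L1)
    then have "integrable lebesgue (\<lambda>x. \<Sum>p\<in>mi_triples \<alpha>. h x p)"
      by (intro Bochner_Integration.integrable_sum)
    then have 1: "mult_monomial \<alpha> (heat z \<phi>) \<in> L1"
      by (simp add: L1_def expand[abs_def])
    moreover have "heat z (mult_monomial \<alpha> \<phi>) \<in> L1"
      using heat_in_L1(2)[OF z L1] assms(2) by simp
    ultimately have "commutator (mult_monomial \<alpha>) (heat z) \<phi> \<in> L1"
      unfolding L1_def commutator_def by simp
    \<comment> \<open>Equality holds at every point, hence almost everywhere.\<close>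
    moreover have "commutator (mult_monomial \<alpha>) (heat z) \<phi> = remainder C \<alpha> \<nu> t \<phi>"
      using comm by (rule ext)
    ultimately show ?thesis
      using 1 by (simp add: eq_in_L1_def z_def)
  qed
  then show ?thesis
    by blast
qed

end
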